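(* Let $n\ge3$, $p\ge2$ and $m\ge1$ be integers and let $X^0$ and $Y$ be given $n$-sided polygons in $\mathbb{R}^p$. The flow $$\frac{dX}{dt}=(-1)^{m+1}M^m\left(X(t)-Y\right),\qquad X(0)=X^0,$$ has a unique solution $X(t)$, given by $$X(t)=\frac1n F\,\mathrm{diag}\left(e^{\lambda_{m,k}t}\right)\bar F\left(X^0-Y\right)+Y .$$ In particular, the solution exists for all time and as $t\to\infty$ converges exponentially to a translate of $Y$, i.e. there are a vector $v\in\mathbb{R}^p$ and constants $C,\delta>0$ such that $|X_j(t)-(Y_j+v)|\le Ce^{-\delta t}$ for all $t\ge0$ and all $j=0,\dots,n-1$.
   Context: A closed $n$-sided polygon in $\mathbb{R}^p$ is an ordered tuple $X=(X_0,\dots,X_{n-1})^T$ of points $X_j\in\mathbb{R}^p$, regarded as a real $n\times p$ matrix with rows $X_j$; indices are taken modulo $n$. $M$ is the $n\times n$ circulant matrix with $-2$ on the diagonal, $1$ in positions $(j,j\pm1)$ (indices modulo $n$), and $0$ elsewhere. $F$ is the $n\times n$ Fourier matrix with $(j,k)$ entry $\omega^{jk}$, $j,k=0,\dots,n-1$, where $\omega=e^{2\pi i/n}$, and $\bar F$ is its entrywise complex conjugate. $\lambda_{m,k}=(-1)^{m+1}\left(-4\sin^2(\pi k/n)\right)^m$, $k=0,\dots,n-1$, and $\mathrm{diag}(e^{\lambda_{m,k}t})$ is the diagonal matrix with diagonal entries $e^{\lambda_{m,0}t},\dots,e^{\lambda_{m,n-1}t}$. *)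

theory Defs
  imports "HOL-Analysis.Analysis" "Jordan_Normal_Form.Matrix"
begin

text \<open>A closed polygon with \<open>n\<close> vertices in \<open>p\<close>-dimensional space is an element of
  \<open>carrier_mat n p\<close> over the reals; its vertices are the rows.\<close>

abbreviation polygons :: "nat \<Rightarrow> nat \<Rightarrow> real mat set" where
  "polygons n p \<equiv> carrier_mat n p"

definition vertex :: "real mat \<Rightarrow> nat \<Rightarrow> real Matrix.vec" where
  "vertex X j = Matrix.row X j"

definition eucl_norm :: "real Matrix.vec \<Rightarrow> real" where
  "eucl_norm v = L2_set (\<lambda>i. vec_index v i) {..<dim_vec v}"

definition second_diff_mat :: "nat \<Rightarrow> real mat" where
  "second_diff_mat n = Matrix.mat n n (\<lambda>(i, j).
     if i = j then - 2
     else if j = (i + 1) mod n \<or> i = (j + 1) mod n then 1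
     else 0)"

definition fourier_mat :: "nat \<Rightarrow> complex mat" where
  "fourier_mat n = Matrix.mat n n (\<lambda>(j, k). exp (2 * of_real pi * \<i> / of_nat n) ^ (j * k))"

definition flow_eigenvalue :: "nat \<Rightarrow> nat \<Rightarrow> nat \<Rightarrow> real" where
  "flow_eigenvalue n m k = (- 1) ^ (m + 1) * (- 4 * (sin (pi * real k / real n))\<^sup>2) ^ m"

text \<open>The type of matrices carries no topology, so differentiation is entrywise.\<close>

definition has_mat_derivative :: "(real \<Rightarrow> real mat) \<Rightarrow> real mat \<Rightarrow> real filter \<Rightarrow> bool" where
  "has_mat_derivative X D F \<longleftrightarrow>
     (\<forall>i<dim_row D. \<forall>j<dim_col D.
        ((\<lambda>t. X t $$ (i, j)) has_real_derivative D $$ (i, j)) F)"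

text \<open>\<open>X\<close> solves the initial value problem on the set \<open>T\<close> of times, which is meant to be an
  interval containing \<open>0\<close>; derivatives at its end points are one-sided.\<close>

definition solves_flow ::
  "nat \<Rightarrow> nat \<Rightarrow> nat \<Rightarrow> real mat \<Rightarrow> real mat \<Rightarrow> real set \<Rightarrow> (real \<Rightarrow> real mat) \<Rightarrow> bool" where
  "solves_flow n p m X0 Y T X \<longleftrightarrow>
     (\<forall>t\<in>T. X t \<in> polygons n p) \<and>
     X 0 = X0 \<and>
     (\<forall>t\<in>T. has_mat_derivative X
        ((- 1) ^ (m + 1) \<cdot>\<^sub>m (second_diff_mat n ^\<^sub>m m * (X t - Y))) (at t within T))"

end

theory Submission
  imports Defs
begin

text \<open>The columns of the Fourier matrix are eigenvectors of the circulant matrix \<open>M\<close>, so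
  \<open>F\<close> diagonalises the flow. For any solution on an interval each Fourier coefficient of
  \<open>X - Y\<close>, multiplied by \<open>exp (- \<lambda> t)\<close>, has derivative zero; this yields the
  formula and uniqueness at once. The formula defines a real solution because
  \<open>\<lambda>\<close> is invariant under \<open>k \<mapsto> n - k\<close>. The zero frequency is constant in time and gives the
  translation vector, the difference of the centroids of \<open>X0\<close> and \<open>Y\<close>; all other eigenvalues
  are negative.\<close>

section \<open>Roots of unity and their orthogonality\<close>

definition unit_root :: "nat \<Rightarrow> complex" where
  "unit_root n = exp (2 * of_real pi * \<i> / of_nat n)"

lemma unit_root_power: "unit_root n ^ k = cis (2 * pi * real k / real n)"
  by (simp add: unit_root_def exp_of_nat_mult[symmetric] cis_conv_exp mult_ac)

lemma unit_root_power_n [simp]: "n \<ge> 1 \<Longrightarrow> unit_root n ^ n = 1"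
  by (simp add: unit_root_power)

lemma cnj_unit_root_power: "cnj (unit_root n ^ k) = inverse (unit_root n ^ k)"
  by (simp only: unit_root_power cis_cnj cis_inverse)

lemma unit_root_power_eq_iff:
  assumes "i < n" "l < n"
  shows "unit_root n ^ i = unit_root n ^ l \<longleftrightarrow> i = l"
proof -
  have "unit_root n ^ k = exp (2 * of_real pi * \<i> * of_nat k / of_nat n)" for k
    by (simp add: unit_root_def exp_of_nat_mult[symmetric] mult_ac)
  then show ?thesis
    using complex_root_unity_eq[of n i l] assms by simp
qed

text \<open>The summand is \<open>z ^ k\<close>, where \<open>z\<close> is a quotient of two powers
  of \<open>unit_root n\<close> and thus itself an n-th root of unity, so the geometric sum vanishes
  unless \<open>z = 1\<close>. The exponents are laid out as in the product of the Fourier matrix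
  with its conjugate.\<close>

lemma sum_unit_root_orthogonal:
  assumes "i < n" "l < n"
  shows "(\<Sum>k<n. unit_root n ^ (i * k) * cnj (unit_root n ^ (k * l)))
           = (if i = l then of_nat n else 0)"
proof -
  define z where "z = unit_root n ^ i * cnj (unit_root n ^ l)"
  have n: "n \<ge> 1" using assms by simp
  have nz: "unit_root n ^ l \<noteq> 0" by (simp add: unit_root_def)
  have "unit_root n ^ (i * k) * cnj (unit_root n ^ (k * l)) = z ^ k" for k
    by (simp add: z_def power_mult power_mult_distrib mult.commute[of k l])
  then have eq: "(\<Sum>k<n. unit_root n ^ (i * k) * cnj (unit_root n ^ (k * l))) = (\<Sum>k<n. z ^ k)"
    by simp
  have "z ^ n = (unit_root n ^ n) ^ i * cnj ((unit_root n ^ n) ^ l)"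
    by (simp only: z_def power_mult_distrib power_mult[symmetric] complex_cnj_power mult.commute)
  then have zn: "z ^ n = 1" using n by simp
  \<comment> \<open>Conjugation inverts roots of unity, so \<open>z = 1\<close> compares two powers
    with exponents below \<open>n\<close>, which agree only for equal exponents.\<close>
  have z1: "z = 1 \<longleftrightarrow> i = l"
    unfolding z_def cnj_unit_root_power unit_root_power_eq_iff[OF assms, symmetric]
    using nz by (metis divide_inverse right_inverse_eq)
  show ?thesis
  proof (cases "i = l")
    case True
    then have "z = 1" using z1 by simp
    then show ?thesis unfolding eq using True by simp
  next
    case False
    then show ?thesis unfolding eq using geometric_sum[of z n] z1 zn by simp
  qed
qed

section \<open>Matrix products, intertwining and powers\<close>

lemma mult_mat_entry:
  assumes "A \<in> carrier_mat nr n" "B \<in> carrier_mat n nc" "i < nr" "j < nc"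
  shows "(A * B) $$ (i, j) = (\<Sum>k<n. A $$ (i, k) * B $$ (k, j))"
  using assms by (auto simp: scalar_prod_def lessThan_atLeast0 intro!: sum.cong)

text \<open>Each factor \<open>A\<close> moves past \<open>B\<close> and becomes \<open>C\<close>.
  This serves for the Fourier matrix and, read from right to left, for its conjugate.\<close>

lemma pow_mat_intertwine:
  fixes A B C :: "'a :: semiring_1 mat"
  assumes "A \<in> carrier_mat n n" "B \<in> carrier_mat n n" "C \<in> carrier_mat n n"
    and AB: "A * B = B * C"
  shows "A ^\<^sub>m m * B = B * C ^\<^sub>m m"
proof (induction m)
  case 0
  show ?case using assms by simp
next
  case (Suc m)
  have "A ^\<^sub>m Suc m * B = A ^\<^sub>m m * (A * B)"
    using assms by (simp add: assoc_mult_mat[of _ n n _ n _ n])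
  also have "\<dots> = (A ^\<^sub>m m * B) * C"
    using assms by (simp add: assoc_mult_mat[of _ n n _ n _ n])
  also have "\<dots> = B * C ^\<^sub>m Suc m"
    unfolding Suc using assms by (simp add: assoc_mult_mat[of _ n n _ n _ n])
  finally show ?case .
qed

lemma mat_diag_pow:
  fixes f :: "nat \<Rightarrow> 'a :: comm_semiring_1"
  shows "mat_diag n f ^\<^sub>m m = mat_diag n (\<lambda>k. f k ^ m)"
proof (induction m)
  case 0
  show ?case by (auto simp: mat_diag_def)
next
  case (Suc m)
  then show ?case by (simp add: mult.commute)
qed

section \<open>Fourier inversion\<close>

lemma fourier_mat_carrier [simp]: "fourier_mat n \<in> carrier_mat n n"
  by (simp add: fourier_mat_def)

lemma fourier_mat_dim [simp]: "dim_row (fourier_mat n) = n" "dim_col (fourier_mat n) = n"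
  by (simp_all add: fourier_mat_def)

lemma second_diff_mat_carrier [simp]: "second_diff_mat n \<in> carrier_mat n n"
  by (simp add: second_diff_mat_def)

lemma fourier_mat_entry:
  "i < n \<Longrightarrow> k < n \<Longrightarrow> fourier_mat n $$ (i, k) = unit_root n ^ (i * k)"
  by (simp add: fourier_mat_def unit_root_def)

lemma fourier_mat_mult_cnj:
  "fourier_mat n * map_mat cnj (fourier_mat n) = of_nat n \<cdot>\<^sub>m 1\<^sub>m n"
proof (rule eq_matI)
  fix i l assume "i < dim_row (of_nat n \<cdot>\<^sub>m 1\<^sub>m n :: complex mat)"
    and "l < dim_col (of_nat n \<cdot>\<^sub>m 1\<^sub>m n :: complex mat)"
  then have il: "i < n" "l < n" by auto
  then have "(fourier_mat n * map_mat cnj (fourier_mat n)) $$ (i, l)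
      = (\<Sum>k<n. unit_root n ^ (i * k) * cnj (unit_root n ^ (k * l)))"
    by (subst mult_mat_entry[of _ n n _ n]) (auto simp: fourier_mat_entry)
  then show "(fourier_mat n * map_mat cnj (fourier_mat n)) $$ (i, l)
      = (of_nat n \<cdot>\<^sub>m 1\<^sub>m n) $$ (i, l)"
    using il by (simp only: sum_unit_root_orthogonal) simp
qed (auto simp: fourier_mat_def)

lemma cnj_fourier_mat_mult:
  "map_mat cnj (fourier_mat n) * fourier_mat n = of_nat n \<cdot>\<^sub>m 1\<^sub>m n"
proof (rule eq_matI)
  fix i l assume "i < dim_row (of_nat n \<cdot>\<^sub>m 1\<^sub>m n :: complex mat)"
    and "l < dim_col (of_nat n \<cdot>\<^sub>m 1\<^sub>m n :: complex mat)"
  then have il: "i < n" "l < n" by auto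
  \<comment> \<open>Commuting the scalar factors gives the orthogonality sum with \<open>i\<close>
    and \<open>l\<close> interchanged.\<close>
  then have "(map_mat cnj (fourier_mat n) * fourier_mat n) $$ (i, l)
      = (\<Sum>k<n. unit_root n ^ (l * k) * cnj (unit_root n ^ (k * i)))"
    by (subst mult_mat_entry[of _ n n _ n])
      (auto simp: fourier_mat_entry mult.commute)
  then show "(map_mat cnj (fourier_mat n) * fourier_mat n) $$ (i, l)
      = (of_nat n \<cdot>\<^sub>m 1\<^sub>m n) $$ (i, l)"
    using il by (simp only: sum_unit_root_orthogonal) simp
qed (auto simp: fourier_mat_def)

section \<open>The spectrum of the second difference matrix\<close>

lemma second_diff_mat_sum:
  fixes f :: "nat \<Rightarrow> complex"
  assumes n: "n \<ge> 3" and i: "i < n"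
  shows "(\<Sum>j<n. of_real (second_diff_mat n $$ (i, j)) * f j)
    = f (if i + 1 = n then 0 else i + 1) + f (if i = 0 then n - 1 else i - 1) - 2 * f i"
proof -
  \<comment> \<open>The cyclic successor and predecessor of \<open>i\<close>, by cases since
    \<open>i - 1\<close> truncates at \<open>0\<close>. For \<open>n \<ge> 3\<close> they differ
    from each other and from \<open>i\<close>, so the row has exactly three nonzero entries.\<close>
  let ?a = "if i + 1 = n then 0 else i + 1" and ?b = "if i = 0 then n - 1 else i - 1"
  have distinct: "?a \<noteq> i" "?b \<noteq> i" "?a \<noteq> ?b" "?a < n" "?b < n"
    using n i by (auto split: if_splits)
  have entry: "second_diff_mat n $$ (i, j) = (if i = j then - 2 else if j = ?a \<or> j = ?b then 1 else 0)"
    if j: "j < n" for j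
  proof -
    have "(i + 1) mod n = ?a" using i by simp
    moreover have "(j + 1) mod n = (if j + 1 = n then 0 else j + 1)" using j by simp
    then have "i = (j + 1) mod n \<longleftrightarrow> j = ?b" using i j n by (simp split: if_split) linarith
    ultimately show ?thesis
      unfolding second_diff_mat_def using i j by (simp only: index_mat case_prod_conv)
  qed
  have "of_real (second_diff_mat n $$ (i, j)) * f j
      = (if j = ?a then f j else 0) + (if j = ?b then f j else 0) - (if j = i then 2 * f j else 0)"
    if "j < n" for j
    unfolding entry[OF that] using distinct(1-3) by (cases "j = i"; cases "j = ?a"; cases "j = ?b") simp_all
  then have "(\<Sum>j<n. of_real (second_diff_mat n $$ (i, j)) * f j)
      = (\<Sum>j<n. (if j = ?a then f j else 0) + (if j = ?b then f j else 0)
                  - (if j = i then 2 * f j else 0))"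
    by simp
  also have "\<dots> = f ?a + f ?b - 2 * f i"
    unfolding sum_subtractf sum.distrib
    using distinct(4,5) i by (simp only: sum.delta finite_lessThan lessThan_iff if_True)
  finally show ?thesis .
qed

text \<open>The condition \<open>z ^ n = 1\<close> closes the wrap-around, so a cyclic shift of the
  powers of \<open>z\<close> is multiplication by \<open>z\<close> or \<open>inverse z\<close>;
  these are the contributions of the two neighbours.\<close>

lemma second_diff_mat_eigenvector:
  fixes z :: complex
  assumes "n \<ge> 3" "i < n" "z ^ n = 1"
  shows "(\<Sum>j<n. of_real (second_diff_mat n $$ (i, j)) * z ^ j) = (z + inverse z - 2) * z ^ i"
proof -
  have z: "z \<noteq> 0" using assms by (metis power_0_left not_numeral_le_zero zero_neq_one)
  have a: "z ^ (if i + 1 = n then 0 else i + 1) = z * z ^ i"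
    using assms(3) by auto
  have "z * z ^ (n - 1) = 1"
    using assms power_Suc[of z "n - 1"] by simp
  have b: "z ^ (if i = 0 then n - 1 else i - 1) = inverse z * z ^ i"
  proof (cases i)
    case 0
    then show ?thesis using \<open>z * z ^ (n - 1) = 1\<close> inverse_unique[of z "z ^ (n - 1)"] by simp
  next
    case (Suc l)
    then show ?thesis using z by (simp add: mult.assoc[symmetric])
  qed
  show ?thesis
    unfolding second_diff_mat_sum[OF assms(1,2)] a b by (simp add: algebra_simps)
qed

definition second_diff_eigenvalue :: "nat \<Rightarrow> nat \<Rightarrow> real" where
  "second_diff_eigenvalue n k = - 4 * (sin (pi * real k / real n))\<^sup>2"

text \<open>On the unit circle \<open>z + inverse z\<close> is twice a cosine, and the double-angle
  formula turns it into a squared sine of half the angle.\<close>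

lemma second_diff_eigenvalue_unit_root:
  "unit_root n ^ k + inverse (unit_root n ^ k) - 2 = of_real (second_diff_eigenvalue n k)"
proof -
  have "cos (2 * (pi * real k / real n)) = 1 - 2 * (sin (pi * real k / real n))\<^sup>2"
    by (rule cos_double_sin)
  then show ?thesis
    unfolding unit_root_power second_diff_eigenvalue_def
    by (auto simp: complex_eq_iff cis_inverse mult.assoc)
qed

lemma smult_mat_cancel:
  fixes A B :: "'a :: idom mat"
  assumes "c \<noteq> 0" "c \<cdot>\<^sub>m A = c \<cdot>\<^sub>m B"
  shows "A = B"
proof (rule eq_matI)
  show dim: "dim_row A = dim_row B" "dim_col A = dim_col B"
    using arg_cong[OF assms(2), of dim_row] arg_cong[OF assms(2), of dim_col] by simp_all
  fix i j assume "i < dim_row B" "j < dim_col B"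
  then show "A $$ (i, j) = B $$ (i, j)"
    using arg_cong[OF assms(2), of "\<lambda>C. C $$ (i, j)"] assms(1) dim by simp
qed

abbreviation complex_mat :: "real mat \<Rightarrow> complex mat" where
  "complex_mat \<equiv> map_mat complex_of_real"

text \<open>Column \<open>k\<close> of the Fourier matrix lists the powers of the n-th root of unity
  \<open>unit_root n ^ k\<close>, to which the eigenvector identity applies row by row.\<close>

lemma second_diff_mat_fourier:
  assumes "n \<ge> 3"
  shows "complex_mat (second_diff_mat n) * fourier_mat n
    = fourier_mat n * mat_diag n (\<lambda>k. of_real (second_diff_eigenvalue n k))"
proof (rule eq_matI)
  fix i k assume "i < dim_row (fourier_mat n * mat_diag n (\<lambda>k. of_real (second_diff_eigenvalue n k)))"
    and "k < dim_col (fourier_mat n * mat_diag n (\<lambda>k. complex_of_real (second_diff_eigenvalue n k)))"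
  then have ik: "i < n" "k < n" by (auto simp: fourier_mat_def mat_diag_def)
  have root: "(unit_root n ^ k) ^ n = 1"
    using assms by (metis One_nat_def Suc_leI le_trans mult.commute power_mult power_one
        unit_root_power_n one_le_numeral)
  have "(complex_mat (second_diff_mat n) * fourier_mat n) $$ (i, k)
      = (\<Sum>j<n. of_real (second_diff_mat n $$ (i, j)) * (unit_root n ^ k) ^ j)"
    using ik by (subst mult_mat_entry[of _ n n _ n])
      (auto simp: fourier_mat_entry second_diff_mat_def power_mult[symmetric] mult.commute)
  also have "\<dots> = of_real (second_diff_eigenvalue n k) * (unit_root n ^ k) ^ i"
    unfolding second_diff_mat_eigenvector[OF assms ik(1) root] second_diff_eigenvalue_unit_root ..
  also have "\<dots> = (fourier_mat n * mat_diag n (\<lambda>k. of_real (second_diff_eigenvalue n k))) $$ (i, k)"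
    using ik by (subst mat_diag_mult_right[of _ n])
      (auto simp: fourier_mat_entry power_mult[symmetric] mult.commute)
  finally show "(complex_mat (second_diff_mat n) * fourier_mat n) $$ (i, k)
      = (fourier_mat n * mat_diag n (\<lambda>k. of_real (second_diff_eigenvalue n k))) $$ (i, k)" .
qed (auto simp: fourier_mat_def second_diff_mat_def mat_diag_def)

text \<open>Left eigenvectors come from right ones: multiplying \<open>A * F = F * L\<close> by
  \<open>G\<close> on both sides gives \<open>G * A * (F * G) = (G * F) * (L * G)\<close>, and both
  \<open>F * G\<close> and \<open>G * F\<close> are \<open>n\<close> times the identity. The
  uniqueness argument needs this form, as it transforms an unknown solution.\<close>

lemma fourier_second_diff_mat:
  assumes "n \<ge> 3"
  shows "map_mat cnj (fourier_mat n) * complex_mat (second_diff_mat n)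
    = mat_diag n (\<lambda>k. of_real (second_diff_eigenvalue n k)) * map_mat cnj (fourier_mat n)"
proof -
  have n: "real n > 0" using assms by simp
  define F where "F = fourier_mat n"
  define G where "G = map_mat cnj (fourier_mat n)"
  define A where "A = complex_mat (second_diff_mat n)"
  define L where "L = mat_diag n (\<lambda>k. complex_of_real (second_diff_eigenvalue n k))"
  have [simp]: "F \<in> carrier_mat n n" "G \<in> carrier_mat n n" "A \<in> carrier_mat n n" "L \<in> carrier_mat n n"
    by (auto simp: F_def G_def A_def L_def)
  have "G * A * (F * G) = (G * F) * (L * G)"
  proof -
    have "A * (F * G) = (A * F) * G"
      by (rule assoc_mult_mat[of _ n n _ n _ n, symmetric]) auto
    also have "\<dots> = F * (L * G)"
      unfolding second_diff_mat_fourier[OF assms, folded F_def A_def L_def]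
      by (rule assoc_mult_mat[of _ n n _ n _ n]) auto
    finally have "A * (F * G) = F * (L * G)" .
    have FG: "F * G \<in> carrier_mat n n" and LG: "L * G \<in> carrier_mat n n"
      by (auto intro: mult_carrier_mat[of _ n n])
    have "G * A * (F * G) = G * (A * (F * G))"
      by (rule assoc_mult_mat[of _ n n _ n _ n]) (simp_all add: FG)
    also have "\<dots> = G * F * (L * G)"
      unfolding \<open>A * (F * G) = F * (L * G)\<close>
      by (rule assoc_mult_mat[of _ n n _ n _ n, symmetric]) (simp_all add: LG)
    finally show ?thesis .
  qed
  moreover have "G * F = of_nat n \<cdot>\<^sub>m 1\<^sub>m n" "F * G = of_nat n \<cdot>\<^sub>m 1\<^sub>m n"
    unfolding F_def G_def by (rule cnj_fourier_mat_mult fourier_mat_mult_cnj)+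
  moreover have GA: "G * A \<in> carrier_mat n n" and LG: "L * G \<in> carrier_mat n n"
    by (auto intro: mult_carrier_mat[of _ n n])
  ultimately have "of_nat n \<cdot>\<^sub>m (G * A) = of_nat n \<cdot>\<^sub>m (L * G)"
    by (simp add: mult_smult_distrib[OF GA one_carrier_mat] right_mult_one_mat[OF GA]
        mult_smult_assoc_mat[OF one_carrier_mat LG] left_mult_one_mat[OF LG] del: assoc_mult_mat)
  then have "G * A = L * G"
    using n by (intro smult_mat_cancel[of "of_nat n" "G * A" "L * G"]) simp_all
  then show ?thesis
    by (simp only: G_def A_def L_def)
qed

section \<open>Fourier multipliers acting on polygons\<close>

definition fourier_multiplier :: "nat \<Rightarrow> (nat \<Rightarrow> complex) \<Rightarrow> real mat \<Rightarrow> complex mat" where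
  "fourier_multiplier n f W = (1 / of_nat n) \<cdot>\<^sub>m
     (fourier_mat n * mat_diag n f * map_mat cnj (fourier_mat n) * complex_mat W)"

text \<open>The frequency \<open>k\<close> enters only through \<open>z = unit_root n ^ k\<close>, so that conjugating the mode
  conjugates \<open>z\<close>, which is the reflection \<open>k \<mapsto> n - k\<close> of frequencies.\<close>

definition fourier_mode :: "nat \<Rightarrow> real mat \<Rightarrow> nat \<Rightarrow> nat \<Rightarrow> complex \<Rightarrow> complex" where
  "fourier_mode n W i j z = z ^ i * (\<Sum>l<n. cnj z ^ l * of_real (W $$ (l, j))) / of_nat n"

lemma fourier_multiplier_carrier [simp]:
  "W \<in> polygons n p \<Longrightarrow> fourier_multiplier n f W \<in> carrier_mat n p"
  unfolding fourier_multiplier_def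
  by (intro smult_carrier_mat mult_carrier_mat[of _ n n]) auto

text \<open>A multiplier is a circulant operator with symbol \<open>f\<close>, and in the flow only
  \<open>f\<close> depends on time. Written as a finite sum over frequencies, its reality, time
  derivative and decay can be treated term by term.\<close>

lemma fourier_multiplier_entry:
  assumes W: "W \<in> polygons n p" and i: "i < n" and j: "j < p"
  shows "fourier_multiplier n f W $$ (i, j) = (\<Sum>k<n. f k * fourier_mode n W i j (unit_root n ^ k))"
proof -
  let ?G = "map_mat cnj (fourier_mat n)"
  have FD: "fourier_mat n * mat_diag n f = Matrix.mat n n (\<lambda>(i, k). fourier_mat n $$ (i, k) * f k)"
    by (rule mat_diag_mult_right) simp
  have GW: "(?G * complex_mat W) $$ (k, j)
      = (\<Sum>l<n. cnj (unit_root n ^ k) ^ l * of_real (W $$ (l, j)))" if "k < n" for k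
    using that W j by (subst mult_mat_entry[of _ n n _ p])
      (auto simp: fourier_mat_entry power_mult)
  \<comment> \<open>Regrouped into two products, both of whose entries are explicit.\<close>
  have "fourier_mat n * mat_diag n f * ?G * complex_mat W
      = (fourier_mat n * mat_diag n f) * (?G * complex_mat W)"
    using W by (intro assoc_mult_mat[of _ n n _ n _ p] mult_carrier_mat[of _ n n]) auto
  moreover have "((fourier_mat n * mat_diag n f) * (?G * complex_mat W)) $$ (i, j)
      = (\<Sum>k<n. (fourier_mat n * mat_diag n f) $$ (i, k) * (?G * complex_mat W) $$ (k, j))"
    using W i j by (intro mult_mat_entry[of _ n n _ p] mult_carrier_mat[of _ n n]) auto
  moreover have "\<dots> = (\<Sum>k<n. unit_root n ^ (i * k) * f k
      * (\<Sum>l<n. cnj (unit_root n ^ k) ^ l * of_real (W $$ (l, j))))"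
    using i unfolding FD by (intro sum.cong refl) (simp only: GW lessThan_iff, simp add: fourier_mat_entry)
  ultimately have "fourier_multiplier n f W $$ (i, j) = (1 / of_nat n) * (\<Sum>k<n. unit_root n ^ (i * k) * f k
      * (\<Sum>l<n. cnj (unit_root n ^ k) ^ l * of_real (W $$ (l, j))))"
    unfolding fourier_multiplier_def using W i j
    by (subst index_smult_mat) (simp_all add: fourier_mat_def)
  also have "\<dots> = (\<Sum>k<n. f k * fourier_mode n W i j (unit_root n ^ k))"
    unfolding sum_distrib_left fourier_mode_def
    by (intro sum.cong refl)
      (simp add: power_mult[symmetric] sum_distrib_left sum_divide_distrib mult_ac)
  finally show ?thesis .
qed

text \<open>Fourier inversion in the form that gives the initial condition: at time 0 every
  exponential is 1.\<close>

lemma fourier_multiplier_one: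
  assumes W: "W \<in> polygons n p" and n: "n \<ge> 1"
  shows "fourier_multiplier n (\<lambda>_. 1) W = complex_mat W"
proof -
  have "fourier_mat n * mat_diag n (\<lambda>_. 1) * map_mat cnj (fourier_mat n) = of_nat n \<cdot>\<^sub>m 1\<^sub>m n"
    using fourier_mat_mult_cnj[of n] by (simp add: right_mult_one_mat[of _ n n])
  then show ?thesis
    unfolding fourier_multiplier_def using W n by (auto simp: mult_smult_assoc_mat[of _ n n _ p])
qed

lemma smult_fourier_multiplier:
  assumes W: "W \<in> polygons n p"
  shows "c \<cdot>\<^sub>m fourier_multiplier n f W = fourier_multiplier n (\<lambda>k. c * f k) W"
proof (rule eq_matI)
  fix i j assume "i < dim_row (fourier_multiplier n (\<lambda>k. c * f k) W)"
    and "j < dim_col (fourier_multiplier n (\<lambda>k. c * f k) W)"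
  then have ij: "i < n" "j < p"
    using fourier_multiplier_carrier[OF W, of "\<lambda>k. c * f k"] by auto
  show "(c \<cdot>\<^sub>m fourier_multiplier n f W) $$ (i, j) = fourier_multiplier n (\<lambda>k. c * f k) W $$ (i, j)"
    using fourier_multiplier_carrier[OF W, of f] ij
    by (subst index_smult_mat) (auto simp: fourier_multiplier_entry[OF W] sum_distrib_left mult_ac)
next
  show "dim_row (c \<cdot>\<^sub>m fourier_multiplier n f W) = dim_row (fourier_multiplier n (\<lambda>k. c * f k) W)"
    "dim_col (c \<cdot>\<^sub>m fourier_multiplier n f W) = dim_col (fourier_multiplier n (\<lambda>k. c * f k) W)"
    by (simp_all add: fourier_multiplier_def)
qed

text \<open>Moving \<open>A ^\<^sub>m m\<close> past \<open>F\<close> turns it into the diagonal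
  matrix \<open>L ^\<^sub>m m\<close>, which merges with \<open>mat_diag n f\<close>. Up to the sign
  \<open>(- 1) ^ (m + 1)\<close>, the flow field therefore multiplies the symbol by
  \<open>flow_eigenvalue n m k\<close>.\<close>

lemma second_diff_pow_fourier_multiplier:
  assumes W: "W \<in> polygons n p" and n: "n \<ge> 3"
  shows "complex_mat (second_diff_mat n) ^\<^sub>m m * fourier_multiplier n f W
    = fourier_multiplier n (\<lambda>k. of_real (second_diff_eigenvalue n k) ^ m * f k) W"
proof -
  define F where "F = fourier_mat n"
  define G where "G = map_mat cnj (fourier_mat n) * complex_mat W"
  define A where "A = complex_mat (second_diff_mat n)"
  define L where "L = mat_diag n (\<lambda>k. complex_of_real (second_diff_eigenvalue n k))"
  have [simp]: "F \<in> carrier_mat n n" "A \<in> carrier_mat n n" "L \<in> carrier_mat n n"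
    by (auto simp: F_def A_def L_def)
  have [simp]: "G \<in> carrier_mat n p"
    unfolding G_def using W by (intro mult_carrier_mat[of _ n n]) auto
  have fm: "fourier_multiplier n f W = (1 / of_nat n) \<cdot>\<^sub>m (F * (mat_diag n f * G))" for f
  proof -
    have "F * mat_diag n f * map_mat cnj (fourier_mat n) * complex_mat W = F * mat_diag n f * G"
      unfolding G_def using W
      by (intro assoc_mult_mat[of _ n n _ n _ p] mult_carrier_mat[of _ n n]) auto
    also have "\<dots> = F * (mat_diag n f * G)"
      by (rule assoc_mult_mat[of _ n n _ n _ p]) auto
    finally show ?thesis
      unfolding fourier_multiplier_def F_def[symmetric] by simp
  qed
  have AF: "A ^\<^sub>m m * F = F * L ^\<^sub>m m"
    by (rule pow_mat_intertwine[of _ n]) (use second_diff_mat_fourier[OF n] in \<open>simp_all add: A_def F_def L_def\<close>)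
  have "A ^\<^sub>m m * (F * (mat_diag n f * G)) = (A ^\<^sub>m m * F) * (mat_diag n f * G)"
    by (rule assoc_mult_mat[of _ n n _ n _ p, symmetric]) (auto intro!: mult_carrier_mat[of _ n n])
  also have "\<dots> = F * (L ^\<^sub>m m * (mat_diag n f * G))"
    unfolding AF by (rule assoc_mult_mat[of _ n n _ n _ p]) (auto intro!: mult_carrier_mat[of _ n n])
  also have "L ^\<^sub>m m * (mat_diag n f * G) = L ^\<^sub>m m * mat_diag n f * G"
    by (rule assoc_mult_mat[of _ n n _ n _ p, symmetric]) auto
  also have "L ^\<^sub>m m * mat_diag n f
      = mat_diag n (\<lambda>k. of_real (second_diff_eigenvalue n k) ^ m * f k)"
    unfolding L_def mat_diag_pow by simp
  finally have "A ^\<^sub>m m * (F * (mat_diag n f * G))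
      = F * (mat_diag n (\<lambda>k. of_real (second_diff_eigenvalue n k) ^ m * f k) * G)" .
  moreover have "A ^\<^sub>m m * ((1 / of_nat n) \<cdot>\<^sub>m (F * (mat_diag n f * G)))
      = (1 / of_nat n) \<cdot>\<^sub>m (A ^\<^sub>m m * (F * (mat_diag n f * G)))"
    by (rule mult_smult_distrib[of _ n n _ p]) (auto intro!: mult_carrier_mat[of _ n n])
  ultimately show ?thesis
    unfolding A_def[symmetric] fm by simp
qed

section \<open>Reflection of frequencies and reality\<close>

lemma sum_reflect_mod:
  fixes g :: "nat \<Rightarrow> 'a :: comm_monoid_add"
  shows "(\<Sum>k<n. g ((n - k) mod n)) = (\<Sum>k<n. g k)"
\<comment> \<open>The reflection is its own inverse; the \<open>mod\<close> sends the value
  \<open>n\<close> at \<open>k = 0\<close> back to \<open>0\<close>.\<close>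
proof (rule sum.reindex_bij_witness[of _ "\<lambda>k. (n - k) mod n" "\<lambda>k. (n - k) mod n"])
  fix k assume "k \<in> {..<n}"
  then show "(n - (n - k) mod n) mod n = k" "(n - k) mod n \<in> {..<n}"
    "(n - (n - k) mod n) mod n = k" "(n - k) mod n \<in> {..<n}"
    by (cases "k = 0"; simp)+
qed simp

lemma unit_root_reflect:
  assumes "k < n"
  shows "unit_root n ^ ((n - k) mod n) = cnj (unit_root n ^ k)"
proof (cases "k = 0")
  case False
  have "unit_root n ^ k * unit_root n ^ (n - k) = 1"
    using assms by (simp add: power_add[symmetric])
  then show ?thesis
    unfolding cnj_unit_root_power using False assms by (simp add: inverse_unique)
qed simp

text \<open>As \<open>W\<close> is real, conjugating a mode reflects its frequency. With symmetric
  real weights conjugation merely permutes the terms of the sum, so the entry is its own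
  conjugate.\<close>

lemma fourier_multiplier_real:
  assumes W: "W \<in> polygons n p" and ij: "i < n" "j < p"
    and f: "\<And>k. k < n \<Longrightarrow> f ((n - k) mod n) = f k"
  shows "of_real (Re (fourier_multiplier n (\<lambda>k. of_real (f k)) W $$ (i, j)))
    = fourier_multiplier n (\<lambda>k. of_real (f k)) W $$ (i, j)"
proof -
  have "cnj (fourier_mode n W i j z) = fourier_mode n W i j (cnj z)" for z
    by (simp add: fourier_mode_def)
  then have "cnj (\<Sum>k<n. of_real (f k) * fourier_mode n W i j (unit_root n ^ k))
      = (\<Sum>k<n. of_real (f ((n - k) mod n)) * fourier_mode n W i j (unit_root n ^ ((n - k) mod n)))"
    unfolding cnj_sum by (intro sum.cong refl) (simp add: f unit_root_reflect)
  also have "\<dots> = (\<Sum>k<n. of_real (f k) * fourier_mode n W i j (unit_root n ^ k))"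
    by (rule sum_reflect_mod[of "\<lambda>k. of_real (f k) * fourier_mode n W i j (unit_root n ^ k)"])
  finally show ?thesis
    unfolding fourier_multiplier_entry[OF W ij] by (simp add: complex_eq_iff sum_negf)
qed

section \<open>Signs and symmetry of the flow eigenvalues\<close>

lemma flow_eigenvalue_eq:
  "flow_eigenvalue n m k = (- 1) ^ (m + 1) * second_diff_eigenvalue n k ^ m"
  by (simp add: flow_eigenvalue_def second_diff_eigenvalue_def)

lemma flow_eigenvalue_reflect:
  assumes "k < n"
  shows "flow_eigenvalue n m ((n - k) mod n) = flow_eigenvalue n m k"
proof (cases "k = 0")
  case False
  have "sin (pi * real (n - k) / real n) = sin (pi - pi * real k / real n)"
    using assms by (simp add: of_nat_diff field_simps)
  then show ?thesis
    using False assms by (simp add: flow_eigenvalue_def)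
qed simp

text \<open>The signs combine to \<open>(- 1) ^ (2 * m + 1)\<close>, negative for either parity of
  \<open>m\<close>, and the sine is positive because its argument lies strictly between 0 and
  pi.\<close>

lemma flow_eigenvalue_neg:
  assumes "0 < k" "k < n"
  shows "flow_eigenvalue n m k < 0"
proof -
  have "sin (pi * real k / real n) > 0"
    using assms by (intro sin_gt_zero) (auto simp: field_simps)
  moreover have "flow_eigenvalue n m k = - ((4 * (sin (pi * real k / real n))\<^sup>2) ^ m)"
    unfolding flow_eigenvalue_def mult_minus_left power_minus[of "4 * _"]
    by (simp add: mult.assoc[symmetric] power_add[symmetric])
  ultimately show ?thesis by simp
qed

section \<open>The Fourier formula for an arbitrary solution\<close>

lemma complex_mat_flow_field:
  assumes "D \<in> polygons n p"
  shows "complex_mat ((- 1) ^ (m + 1) \<cdot>\<^sub>m (second_diff_mat n ^\<^sub>m m * D))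
    = (- 1) ^ (m + 1) \<cdot>\<^sub>m (complex_mat (second_diff_mat n) ^\<^sub>m m * complex_mat D)"
proof -
  have "complex_mat ((- 1) ^ (m + 1) \<cdot>\<^sub>m (second_diff_mat n ^\<^sub>m m * D))
      = (- 1) ^ (m + 1) \<cdot>\<^sub>m complex_mat (second_diff_mat n ^\<^sub>m m * D)"
    by (rule eq_matI) auto
  also have "complex_mat (second_diff_mat n ^\<^sub>m m * D)
      = complex_mat (second_diff_mat n) ^\<^sub>m m * complex_mat D"
    using assms by (subst of_real_hom.mat_hom_mult[of _ n n _ p])
      (simp_all add: of_real_hom.mat_hom_pow[of _ n])
  finally show ?thesis .
qed

lemma flow_solution_formula:
  assumes n: "n \<ge> 3" and X0: "X0 \<in> polygons n p" and Y: "Y \<in> polygons n p"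
    and T: "is_interval T" "0 \<in> T" and Z: "solves_flow n p m X0 Y T Z" and t: "t \<in> T"
  shows "complex_mat (Z t)
    = fourier_multiplier n (\<lambda>k. of_real (exp (flow_eigenvalue n m k * t))) (X0 - Y) + complex_mat Y"
proof -
  define G where "G = map_mat cnj (fourier_mat n)"
  define A where "A = complex_mat (second_diff_mat n)"
  define B where "B s = (- 1) ^ (m + 1) \<cdot>\<^sub>m (second_diff_mat n ^\<^sub>m m * (Z s - Y))" for s
  have ZC: "Z s \<in> polygons n p" if "s \<in> T" for s
    using Z that by (simp add: solves_flow_def)
  \<comment> \<open>Matrix subtraction takes its dimensions from the second operand, so this holds
    at every \<open>s\<close>, also outside \<open>T\<close>.\<close>
  have DC [simp]: "Z s - Y \<in> polygons n p" for s
    by (rule minus_carrier_mat[OF Y])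
  have BC [simp]: "B s \<in> polygons n p" for s
    unfolding B_def by (intro smult_carrier_mat mult_carrier_mat[of _ n n] pow_carrier_mat) auto
  have [simp]: "G \<in> carrier_mat n n" "A \<in> carrier_mat n n"
    by (auto simp: G_def A_def)
  have GA: "G * A ^\<^sub>m m = mat_diag n (\<lambda>k. of_real (second_diff_eigenvalue n k) ^ m) * G"
    unfolding mat_diag_pow[symmetric]
    by (rule pow_mat_intertwine[of _ n, symmetric])
      (use fourier_second_diff_mat[OF n] in \<open>simp_all add: A_def G_def\<close>)
  \<comment> \<open>In Fourier coordinates the field is diagonal: each coefficient is only scaled by
    its own eigenvalue.\<close>
  have GB: "(G * complex_mat (B s)) $$ (k, j)
      = of_real (flow_eigenvalue n m k) * (G * complex_mat (Z s - Y)) $$ (k, j)"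
    if kj: "k < n" "j < p" for s k j
  proof -
    let ?D = "complex_mat (Z s - Y)"
    let ?c = "(- 1) ^ (m + 1) :: complex"
    have D: "?D \<in> carrier_mat n p" by simp
    have GD: "G * ?D \<in> carrier_mat n p" by (rule mult_carrier_mat[OF _ D]) simp
    have "complex_mat (B s) = ?c \<cdot>\<^sub>m (A ^\<^sub>m m * ?D)"
      unfolding B_def A_def by (rule complex_mat_flow_field[OF DC])
    then have "G * complex_mat (B s) = ?c \<cdot>\<^sub>m (G * (A ^\<^sub>m m * ?D))"
      by (simp add: mult_smult_distrib[of _ n n _ p] mult_carrier_mat[of _ n n])
    also have "G * (A ^\<^sub>m m * ?D) = (G * A ^\<^sub>m m) * ?D"
      by (rule assoc_mult_mat[of _ n n _ n _ p, symmetric]) simp_all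
    also have "\<dots> = mat_diag n (\<lambda>k. of_real (second_diff_eigenvalue n k) ^ m) * (G * ?D)"
      unfolding GA by (rule assoc_mult_mat[of _ n n _ n _ p]) simp_all
    also have "\<dots> = Matrix.mat n p (\<lambda>(k, j). of_real (second_diff_eigenvalue n k) ^ m * (G * ?D) $$ (k, j))"
      by (rule mat_diag_mult_left[OF GD])
    finally show ?thesis
      using kj by (simp add: flow_eigenvalue_eq mult.assoc)
  qed
  have sol: "(G * complex_mat (Z t - Y)) $$ (k, j)
      = of_real (exp (flow_eigenvalue n m k * t)) * (G * complex_mat (X0 - Y)) $$ (k, j)"
    if kj: "k < n" "j < p" for k j
  proof -
    define l where "l = flow_eigenvalue n m k"
    \<comment> \<open>A Fourier coefficient of \<open>Z s - Y\<close> times the integrating factor.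
      The exponential sits next to the real entries so that their real derivatives carry over
      through \<open>of_real\<close>.\<close>
    define g where "g s = (\<Sum>i<n. G $$ (k, i) * of_real (exp (- l * s) * (Z s $$ (i, j) - Y $$ (i, j))))" for s
    have GE: "(G * complex_mat C) $$ (k, j) = (\<Sum>i<n. G $$ (k, i) * of_real (C $$ (i, j)))"
      if "C \<in> polygons n p" for C
      using that kj by (subst mult_mat_entry[of _ n n _ p]) auto
    have gE: "g s = of_real (exp (- l * s)) * (G * complex_mat (Z s - Y)) $$ (k, j)" for s
      unfolding GE[OF DC] g_def sum_distrib_left using Y kj
      by (intro sum.cong refl) (auto simp: mult_ac)
    have "(g has_vector_derivative 0) (at s within T)" if s: "s \<in> T" for s
    proof -
      have "has_mat_derivative Z (B s) (at s within T)"
        using Z s by (simp add: solves_flow_def B_def)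
      then have der: "((\<lambda>s. Z s $$ (i, j)) has_real_derivative B s $$ (i, j)) (at s within T)"
        if "i < n" for i
        using that kj BC[of s] unfolding has_mat_derivative_def carrier_mat_def by auto
      have exp_der: "((\<lambda>s. exp (- l * s) * (Z s $$ (i, j) - Y $$ (i, j))) has_real_derivative
          exp (- l * s) * (B s $$ (i, j) - l * (Z s $$ (i, j) - Y $$ (i, j)))) (at s within T)"
        if "i < n" for i
        by (rule derivative_eq_intros refl der[OF that])+ (simp add: algebra_simps)
      have "(g has_vector_derivative (\<Sum>i<n. G $$ (k, i) *
          of_real (exp (- l * s) * (B s $$ (i, j) - l * (Z s $$ (i, j) - Y $$ (i, j)))))) (at s within T)"
        unfolding g_def
        by (intro has_vector_derivative_sum has_vector_derivative_mult_right
            has_vector_derivative_of_real exp_der) simp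
      \<comment> \<open>The product rule leaves the defect of the scalar equation
        \<open>y' = l * y\<close> for the Fourier coefficient, which \<open>GB\<close> makes
        vanish.\<close>
      also have "(\<Sum>i<n. G $$ (k, i) *
          of_real (exp (- l * s) * (B s $$ (i, j) - l * (Z s $$ (i, j) - Y $$ (i, j)))))
        = of_real (exp (- l * s)) * ((G * complex_mat (B s)) $$ (k, j)
            - of_real l * (G * complex_mat (Z s - Y)) $$ (k, j))"
        unfolding GE[OF DC] GE[OF BC] sum_distrib_left sum_subtractf[symmetric] using Y kj
        by (intro sum.cong refl) (auto simp: algebra_simps)
      also have "\<dots> = 0"
        unfolding GB[OF kj] l_def by simp
      finally show ?thesis .
    qed
    \<comment> \<open>An interval is convex, so a vanishing derivative within \<open>T\<close>,
      one-sided at end points, forces constancy.\<close>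
    then obtain c where "\<And>s. s \<in> T \<Longrightarrow> g s = c"
      using has_vector_derivative_zero_constant[of T g] T(1) is_interval_convex by blast
    then have "g t = g 0" using t T(2) by simp
    moreover have "Z 0 = X0" using Z by (simp add: solves_flow_def)
    ultimately have "of_real (exp (- l * t)) * (G * complex_mat (Z t - Y)) $$ (k, j)
        = (G * complex_mat (X0 - Y)) $$ (k, j)"
      by (simp add: gE)
    then have "of_real (exp (l * t) * exp (- l * t)) * (G * complex_mat (Z t - Y)) $$ (k, j)
        = of_real (exp (l * t)) * (G * complex_mat (X0 - Y)) $$ (k, j)"
      by (metis mult.assoc of_real_mult)
    then show ?thesis
      by (simp add: exp_add[symmetric] l_def del: of_real_mult)
  qed
  define f where "f k = complex_of_real (exp (flow_eigenvalue n m k * t))" for k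
  have WC: "X0 - Y \<in> polygons n p" by (rule minus_carrier_mat[OF Y])
  have GW: "G * complex_mat (X0 - Y) \<in> carrier_mat n p"
    using WC by (intro mult_carrier_mat[of _ n n]) auto
  \<comment> \<open>This is \<open>sol\<close> in matrix form. Applying the Fourier matrix to it
    recovers \<open>n\<close> times \<open>Z t - Y\<close> by Fourier inversion.\<close>
  have "mat_diag n f * (G * complex_mat (X0 - Y)) = G * complex_mat (Z t - Y)"
    unfolding mat_diag_mult_left[OF GW]
  proof (rule eq_matI)
    fix k j assume "k < dim_row (G * complex_mat (Z t - Y))" "j < dim_col (G * complex_mat (Z t - Y))"
    then have "k < n" "j < p" using Y by (auto simp: G_def)
    then show "Matrix.mat n p (\<lambda>(i, j). f i * (G * complex_mat (X0 - Y)) $$ (i, j)) $$ (k, j)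
        = (G * complex_mat (Z t - Y)) $$ (k, j)"
      by (simp only: sol index_mat f_def case_prod_conv)
  qed (use Y in \<open>auto simp: G_def\<close>)
  moreover have "fourier_mat n * mat_diag n f * G * complex_mat (X0 - Y)
      = fourier_mat n * mat_diag n f * (G * complex_mat (X0 - Y))"
    using WC by (intro assoc_mult_mat[of _ n n _ n _ p] mult_carrier_mat[of _ n n]) auto
  moreover have "\<dots> = fourier_mat n * (mat_diag n f * (G * complex_mat (X0 - Y)))"
    by (rule assoc_mult_mat[of _ n n _ n _ p]) (simp_all add: GW)
  moreover have "fourier_mat n * (G * complex_mat (Z t - Y)) = fourier_mat n * G * complex_mat (Z t - Y)"
    by (rule assoc_mult_mat[of _ n n _ n _ p, symmetric]) simp_all
  moreover have "\<dots> = of_nat n \<cdot>\<^sub>m complex_mat (Z t - Y)"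
    unfolding G_def fourier_mat_mult_cnj
    by (subst mult_smult_assoc_mat[of _ n n _ p]) (simp_all add: left_mult_one_mat[of _ n p])
  ultimately have "fourier_multiplier n f (X0 - Y) = complex_mat (Z t - Y)"
    unfolding fourier_multiplier_def G_def[symmetric] using n Y by auto
  then have eq: "fourier_multiplier n f (X0 - Y) + complex_mat Y = complex_mat (Z t - Y) + complex_mat Y"
    by simp
  \<comment> \<open>Adding \<open>Y\<close> back restores \<open>Z t\<close> because
    \<open>solves_flow\<close> fixes the size of \<open>Z t\<close> on \<open>T\<close>.\<close>
  have "complex_mat (Z t) = complex_mat (Z t - Y) + complex_mat Y"
    using Y ZC[OF t] by (intro eq_matI) auto
  then show ?thesis using eq unfolding f_def by simp
qed

section \<open>Existence: the formula defines a real solution\<close>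

definition flow_solution :: "nat \<Rightarrow> nat \<Rightarrow> real mat \<Rightarrow> real mat \<Rightarrow> real \<Rightarrow> real mat" where
  "flow_solution n m X0 Y t = map_mat Re (fourier_multiplier n
     (\<lambda>k. of_real (exp (flow_eigenvalue n m k * t))) (X0 - Y)) + Y"

lemma flow_solution_entry:
  assumes X0: "X0 \<in> polygons n p" and Y: "Y \<in> polygons n p" and ij: "i < n" "j < p"
  shows "flow_solution n m X0 Y t $$ (i, j)
    = (\<Sum>k<n. exp (flow_eigenvalue n m k * t) * Re (fourier_mode n (X0 - Y) i j (unit_root n ^ k)))
      + Y $$ (i, j)"
proof -
  have W: "X0 - Y \<in> polygons n p" by (rule minus_carrier_mat[OF Y])
  show ?thesis
    unfolding flow_solution_def using Y ij
    by (simp add: carrier_matD[OF fourier_multiplier_carrier[OF W]] fourier_multiplier_entry[OF W])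
qed

text \<open>The eigenvalues are invariant under reflection, so the multiplier already has real
  entries and \<open>Re\<close> in \<open>flow_solution\<close> discards nothing.\<close>

lemma flow_solution_complex:
  assumes X0: "X0 \<in> polygons n p" and Y: "Y \<in> polygons n p"
  shows "complex_mat (flow_solution n m X0 Y t)
    = fourier_multiplier n (\<lambda>k. of_real (exp (flow_eigenvalue n m k * t))) (X0 - Y) + complex_mat Y"
proof -
  have W: "X0 - Y \<in> polygons n p" by (rule minus_carrier_mat[OF Y])
  let ?U = "fourier_multiplier n (\<lambda>k. of_real (exp (flow_eigenvalue n m k * t))) (X0 - Y)"
  have U: "?U \<in> carrier_mat n p" by (rule fourier_multiplier_carrier[OF W])
  have "of_real (Re (?U $$ (i, j))) = ?U $$ (i, j)" if "i < n" "j < p" for i j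
    by (rule fourier_multiplier_real[OF W that]) (simp add: flow_eigenvalue_reflect)
  then show ?thesis
    unfolding flow_solution_def using U Y by (intro eq_matI) auto
qed

text \<open>Differentiating the sum of exponentials brings down \<open>flow_eigenvalue n m k\<close>
  at frequency \<open>k\<close>, and the flow field multiplies the symbol by the same
  factor.\<close>

lemma flow_solution_solves:
  assumes n: "n \<ge> 3" and X0: "X0 \<in> polygons n p" and Y: "Y \<in> polygons n p"
  shows "solves_flow n p m X0 Y T (flow_solution n m X0 Y)"
proof -
  let ?X = "flow_solution n m X0 Y"
  let ?l = "flow_eigenvalue n m"
  have W [simp]: "X0 - Y \<in> polygons n p" by (rule minus_carrier_mat[OF Y])
  have XC [simp]: "?X t \<in> polygons n p" for t
    unfolding flow_solution_def using fourier_multiplier_carrier[OF W] Y by (intro add_carrier_mat) auto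
  have "complex_mat (?X 0) = complex_mat (X0 - Y) + complex_mat Y"
    unfolding flow_solution_complex[OF X0 Y] using n by (simp add: fourier_multiplier_one[OF W])
  also have "\<dots> = complex_mat X0"
    using X0 Y by (intro eq_matI) auto
  finally have init: "?X 0 = X0" by (rule of_real_hom.mat_hom_inj)
  have "has_mat_derivative ?X ((- 1) ^ (m + 1) \<cdot>\<^sub>m (second_diff_mat n ^\<^sub>m m * (?X t - Y))) (at t within T)"
    (is "has_mat_derivative _ ?B _") for t
  proof -
    let ?U = "fourier_multiplier n (\<lambda>k. of_real (exp (?l k * t))) (X0 - Y)"
    have U: "?U \<in> carrier_mat n p" by (rule fourier_multiplier_carrier[OF W])
    have "?X t - Y \<in> polygons n p" by (rule minus_carrier_mat[OF Y])
    then have BC: "?B \<in> polygons n p"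
      by (intro smult_carrier_mat mult_carrier_mat[of _ n n] pow_carrier_mat) auto
    have "complex_mat (?X t - Y) = complex_mat (?X t) - complex_mat Y"
      using Y carrier_matD[OF XC[of t]] by (intro eq_matI) auto
    also have "\<dots> = ?U"
      unfolding flow_solution_complex[OF X0 Y] using Y carrier_matD[OF U] by (intro eq_matI) auto
    finally have "complex_mat ?B = (- 1) ^ (m + 1) \<cdot>\<^sub>m (complex_mat (second_diff_mat n) ^\<^sub>m m * ?U)"
      by (simp only: complex_mat_flow_field[OF \<open>?X t - Y \<in> polygons n p\<close>])
    also have "\<dots> = fourier_multiplier n (\<lambda>k. of_real (?l k * exp (?l k * t))) (X0 - Y)"
      unfolding second_diff_pow_fourier_multiplier[OF W n] smult_fourier_multiplier[OF W]
      by (simp add: flow_eigenvalue_eq mult.assoc)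
    finally have B: "complex_mat ?B = fourier_multiplier n (\<lambda>k. of_real (?l k * exp (?l k * t))) (X0 - Y)" .
    have "((\<lambda>t. ?X t $$ (i, j)) has_real_derivative ?B $$ (i, j)) (at t within T)"
      if ij: "i < n" "j < p" for i j
    proof -
      have "?B $$ (i, j) = Re (complex_mat ?B $$ (i, j))"
        using ij by (simp only: index_map_mat carrier_matD[OF BC] Re_complex_of_real)
      also have "\<dots> = (\<Sum>k<n. ?l k * exp (?l k * t) * Re (fourier_mode n (X0 - Y) i j (unit_root n ^ k)))"
        unfolding B fourier_multiplier_entry[OF W ij] Re_sum
        by (intro sum.cong refl) (simp del: of_real_mult)
      finally have Bij: "?B $$ (i, j)
          = (\<Sum>k<n. ?l k * exp (?l k * t) * Re (fourier_mode n (X0 - Y) i j (unit_root n ^ k)))" .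
      have "((\<lambda>t. exp (?l k * t) * c) has_real_derivative ?l k * exp (?l k * t) * c) (at t within T)" for k c
        by (rule derivative_eq_intros refl)+ simp
      then have "((\<lambda>t. (\<Sum>k<n. exp (?l k * t) * Re (fourier_mode n (X0 - Y) i j (unit_root n ^ k)))
            + Y $$ (i, j)) has_real_derivative
          (\<Sum>k<n. ?l k * exp (?l k * t) * Re (fourier_mode n (X0 - Y) i j (unit_root n ^ k))) + 0) (at t within T)"
        by (intro DERIV_add DERIV_sum DERIV_const)
      then show ?thesis
        unfolding Bij flow_solution_entry[OF X0 Y ij] by simp
    qed
    then show ?thesis
      unfolding has_mat_derivative_def carrier_matD[OF BC] by blast
  qed
  then show ?thesis
    unfolding solves_flow_def using init by simp
qed

section \<open>Exponential convergence to a translate\<close>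

lemma flow_solution_converges:
  assumes n: "n \<ge> 3" and m: "m \<ge> 1" and X0: "X0 \<in> polygons n p" and Y: "Y \<in> polygons n p"
  shows "\<exists>v \<in> carrier_vec p. \<exists>C > 0. \<exists>\<delta> > 0. \<forall>t \<ge> 0. \<forall>i < n.
    eucl_norm (vertex (flow_solution n m X0 Y t) i - (vertex Y i + v)) \<le> C * exp (- \<delta> * t)"
proof -
  let ?l = "flow_eigenvalue n m" and ?X = "flow_solution n m X0 Y"
  define r where "r i j k = Re (fourier_mode n (X0 - Y) i j (unit_root n ^ k))" for i j k
  \<comment> \<open>The spectral gap, that is the slowest decay rate among the nonzero frequencies;
    such frequencies exist as \<open>n \<ge> 3\<close>.\<close>
  define \<delta> where "\<delta> = Min ((\<lambda>k. - ?l k) ` {1..<n})"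
  \<comment> \<open>The sum runs over all vertices as well, so that one constant serves every
    \<open>i\<close>.\<close>
  define c where "c = (\<Sum>i<n. \<Sum>j<p. \<Sum>k=1..<n. \<bar>r i j k\<bar>)"
  \<comment> \<open>At frequency 0 the root is 1 and the mode is the mean of column \<open>j\<close>
    of \<open>X0 - Y\<close>. It is the same for every vertex, so the vertex index \<open>0\<close>
    is an arbitrary choice.\<close>
  define v where "v = Matrix.vec p (\<lambda>j. r 0 j 0)"
  have \<delta>: "\<delta> > 0"
    unfolding \<delta>_def using n flow_eigenvalue_neg[of _ n m] by (subst Min_gr_iff) auto
  have decay: "?l k \<le> - \<delta>" if "k \<in> {1..<n}" for k
  proof -
    have "\<delta> \<le> - ?l k" unfolding \<delta>_def using that by (intro Min_le) auto
    then show ?thesis by simp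
  qed
  \<comment> \<open>Here \<open>m \<ge> 1\<close> matters: for \<open>m = 0\<close> the convention
    \<open>0 ^ 0 = 1\<close> would make this eigenvalue \<open>- 1\<close>.\<close>
  have l0: "?l 0 = 0" using m by (simp add: flow_eigenvalue_def)
  have entry: "?X t $$ (i, j) - (Y $$ (i, j) + r 0 j 0) = (\<Sum>k=1..<n. exp (?l k * t) * r i j k)"
    if "i < n" "j < p" for i j t
  proof -
    have "?X t $$ (i, j) = (\<Sum>k\<in>{0..<n}. exp (?l k * t) * r i j k) + Y $$ (i, j)"
      unfolding r_def flow_solution_entry[OF X0 Y that] by (simp add: lessThan_atLeast0)
    also have "(\<Sum>k\<in>{0..<n}. exp (?l k * t) * r i j k) = r i j 0 + (\<Sum>k=1..<n. exp (?l k * t) * r i j k)"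
      using n by (subst sum.atLeast_Suc_lessThan) (simp_all add: l0)
    also have "r i j 0 = r 0 j 0" by (simp add: r_def fourier_mode_def)
    finally show ?thesis by simp
  qed
  \<comment> \<open>The added 1 keeps the constant positive when all amplitudes at nonzero
    frequencies vanish.\<close>
  have bound: "eucl_norm (vertex (?X t) i - (vertex Y i + v)) \<le> (c + 1) * exp (- \<delta> * t)"
    if t: "t \<ge> 0" and i: "i < n" for t i
  proof -
    have XC: "?X t \<in> polygons n p"
      using flow_solution_solves[OF n X0 Y, of m UNIV] by (simp add: solves_flow_def)
    have dim: "dim_vec (vertex (?X t) i - (vertex Y i + v)) = p"
      by (simp add: v_def)
    have "eucl_norm (vertex (?X t) i - (vertex Y i + v))
        \<le> (\<Sum>j<p. \<bar>vec_index (vertex (?X t) i - (vertex Y i + v)) j\<bar>)"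
      unfolding eucl_norm_def dim by (rule L2_set_le_sum_abs)
    also have "\<dots> = (\<Sum>j<p. \<bar>\<Sum>k=1..<n. exp (?l k * t) * r i j k\<bar>)"
    proof (intro sum.cong refl)
      fix j assume "j \<in> {..<p}"
      then have "vec_index (vertex (?X t) i - (vertex Y i + v)) j = ?X t $$ (i, j) - (Y $$ (i, j) + r 0 j 0)"
        using XC Y i by (simp add: vertex_def v_def)
      then show "\<bar>vec_index (vertex (?X t) i - (vertex Y i + v)) j\<bar>
          = \<bar>\<Sum>k=1..<n. exp (?l k * t) * r i j k\<bar>"
        using \<open>j \<in> {..<p}\<close> i by (simp only: entry lessThan_iff)
    qed
    also have "\<dots> \<le> (\<Sum>j<p. \<Sum>k=1..<n. \<bar>r i j k\<bar> * exp (- \<delta> * t))"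
    proof (rule sum_mono, rule order_trans[OF sum_abs], rule sum_mono)
      fix j k assume "k \<in> {1..<n}"
      \<comment> \<open>Since \<open>t \<ge> 0\<close>, multiplying \<open>decay\<close> by
        \<open>t\<close> keeps its direction, so every nonzero frequency decays at least at the gap
        rate.\<close>
      then have "exp (?l k * t) \<le> exp (- \<delta> * t)"
        using mult_right_mono[OF decay t] by simp
      then show "\<bar>exp (?l k * t) * r i j k\<bar> \<le> \<bar>r i j k\<bar> * exp (- \<delta> * t)"
        by (simp add: abs_mult mult.commute mult_left_mono)
    qed
    also have "\<dots> = (\<Sum>j<p. \<Sum>k=1..<n. \<bar>r i j k\<bar>) * exp (- \<delta> * t)"
      by (simp add: sum_distrib_right)
    also have "\<dots> \<le> (c + 1) * exp (- \<delta> * t)"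
    proof (rule mult_right_mono)
      have "(\<Sum>j<p. \<Sum>k=1..<n. \<bar>r i j k\<bar>) \<le> c"
        unfolding c_def using i
        by (intro member_le_sum[of i "{..<n}" "\<lambda>i. \<Sum>j<p. \<Sum>k=1..<n. \<bar>r i j k\<bar>"] sum_nonneg) auto
      then show "(\<Sum>j<p. \<Sum>k=1..<n. \<bar>r i j k\<bar>) \<le> c + 1" by simp
    qed simp
    finally show ?thesis .
  qed
  have "c \<ge> 0" unfolding c_def by (intro sum_nonneg) simp
  then have "c + 1 > 0" by simp
  moreover have "v \<in> carrier_vec p" by (simp add: v_def)
  ultimately show ?thesis using \<delta> bound by blast
qed

theorem theorem6p1:
  fixes n p m :: nat and X0 Y :: "real mat"
  assumes "n \<ge> 3" and "p \<ge> 2" and "m \<ge> 1"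
    and "X0 \<in> polygons n p" and "Y \<in> polygons n p"
  shows "\<exists>X :: real \<Rightarrow> real mat.
    solves_flow n p m X0 Y UNIV X \<and>
    (\<forall>T Z. is_interval T \<and> 0 \<in> T \<and> solves_flow n p m X0 Y T Z \<longrightarrow> (\<forall>t\<in>T. Z t = X t)) \<and>
    (\<forall>t. map_mat complex_of_real (X t) =
       (1 / of_nat n) \<cdot>\<^sub>m
         (fourier_mat n *
          mat_diag n (\<lambda>k. complex_of_real (exp (flow_eigenvalue n m k * t))) *
          map_mat cnj (fourier_mat n) *
          map_mat complex_of_real (X0 - Y))
       + map_mat complex_of_real Y) \<and>
    (\<exists>v \<in> carrier_vec p. \<exists>C > 0. \<exists>\<delta> > 0. \<forall>t \<ge> 0. \<forall>j < n.
       eucl_norm (vertex (X t) j - (vertex Y j + v)) \<le> C * exp (- \<delta> * t))"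
proof (intro exI[of _ "flow_solution n m X0 Y"] conjI allI impI ballI)
  show "solves_flow n p m X0 Y UNIV (flow_solution n m X0 Y)"
    by (rule flow_solution_solves[OF assms(1,4,5)])
next
  fix T Z t
  assume "is_interval T \<and> 0 \<in> T \<and> solves_flow n p m X0 Y T Z" and "t \<in> T"
  \<comment> \<open>Both functions obey the same formula after embedding into complex matrices, and
    the embedding is injective.\<close>
  then have "complex_mat (Z t) = complex_mat (flow_solution n m X0 Y t)"
    unfolding flow_solution_complex[OF assms(4,5)]
    using flow_solution_formula[OF assms(1,4,5)] by blast
  then show "Z t = flow_solution n m X0 Y t"
    by (rule of_real_hom.mat_hom_inj)
next
  fix t
  show "complex_mat (flow_solution n m X0 Y t) =
      (1 / of_nat n) \<cdot>\<^sub>m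
         (fourier_mat n *
          mat_diag n (\<lambda>k. complex_of_real (exp (flow_eigenvalue n m k * t))) *
          map_mat cnj (fourier_mat n) *
          complex_mat (X0 - Y))
       + complex_mat Y"
    unfolding flow_solution_complex[OF assms(4,5)] fourier_multiplier_def ..
qed (rule flow_solution_converges[OF assms(1,3,4,5)])

end
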